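(* Let $n\le 4$ and consider the single-input system $\dot x(t)=Ax(t)+Bu(t)$, $x(t)\in\mathbb{R}^n$, $u(t)\in\mathbb{R}$, in controllable canonical form (so that $(A,B)$ is a controllable pair), open-loop unstable. Fix $\sigma\in(0,1)$. Let a periodic jammer with parameters $(T_{\mathrm{off}}^{\mathrm{cr}},T)$, $0<T_{\mathrm{off}}^{\mathrm{cr}}<T$, be given. Then there exists $\lambda^{*}>\|N\|+1/2$ such that for all $\lambda\ge\lambda^{*}$ the system with control gain $K_\lambda$, i.e. with $u(t)=K_\lambda x(t_k)$ for $t\in[t_k,t_{k+1}[$, where the update times $\{t_k\}$ are given by the jammer-resilient triggering strategy defined in the context, is asymptotically stable.
   Context: $|\cdot|$ is the Euclidean norm and $\|\cdot\|$ the induced matrix 2-norm. Controllable canonical form: for real numbers $a_1,\dots,a_n$, $$A=\begin{bmatrix}0&1&0&\cdots&0\\0&0&1&\cdots&0\\ \vdots&\vdots&\vdots&\ddots&\vdots\\0&0&0&\cdots&1\\-a_n&-a_{n-1}&-a_{n-2}&\cdots&-a_1\end{bmatrix},\qquad B=\begin{bmatrix}0\\0\\ \vdots\\0\\1\end{bmatrix}.$$ "Open-loop unstable" means that $\dot x=Ax$ is unstable. Gain: for $\lambda>0$, $K_\lambda=[-k_n+a_n,\,-k_{n-1}+a_{n-1},\dots,-k_1+a_1]$ with $k_i=\binom{n}{i}\lambda^i$, $i=1,\dots,n$. All eigenvalues of $A+BK_\lambda$ equal $-\lambda$, with geometric multiplicity $1$. Jordan decomposition: $A+BK_\lambda=T_\lambda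 J_\lambda T_\lambda^{-1}$ with $J_\lambda=-\lambda I+N$, where $N$ is the $n\times n$ matrix with ones on the first superdiagonal and zeros elsewhere, and $T_\lambda$ is an invertible real matrix built from the eigenvector and generalized eigenvectors, chosen so that the entries of $T_\lambda$ and $T_\lambda^{-1}$ are rational functions of $\lambda>0$. The constant $\tau_\lambda$: for $\lambda>\|N\|+1/2$, consider the (jammer-free) event-triggered closed loop $\dot x=Ax+BK_\lambda x(t_k)$ on $[t_k,t_{k+1}[$, $t_1=0$, with $e(t)=x(t_k)-x(t)$, $x_\lambda=T_\lambda^{-1}x$, $e_\lambda=T_\lambda^{-1}e$, in which $t_{k+1}$ is the first time after $t_k$ at which the condition $$|e_\lambda(t)|^2\le\frac{\sigma(2\lambda-1-2\|N\|)}{\|T_\lambda^{-1}BK_\lambda T_\lambda\|^2}|x_\lambda(t)|^2$$ is about to be violated. Then $\tau_\lambda>0$ denotes a constant (depending on $\lambda$) such that $t_{k+1}-t_k\ge\tau_\lambda$ for all $k\in\mathbb{N}$ and all initial states (such a constant exists for each $\lambda$). Jammer: it is periodic with period $T$. In the $p$-th period ($p\in\mathbb{N}$, $p\geq 1$) it sleeps, so that communication is possible, for $(p-1)T\le t\le (p-1)T+T_{\mathrm{off}}$, and it is active, so that no control data can be sent, for $(p-1)T+T_{\mathrm{off}}\le t\le pT$. $T_{\mathrm{off}}^{\mathrm{cr}}$ is a known uniform lower bound of the sleeping durations, and the worst-case jamming scenario $T_{\mathrm{off}}=T_{\mathrm{off}}^{\mathrm{cr}}$ is assumed. Triggering strategy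 in the presence of the jammer: the update times in the $p$-th period are $$t^*_{k,p}\in\{\,l\tau_\lambda \mid l\tau_\lambda\in[(p-1)T,(p-1)T+T_{\mathrm{off}}^{\mathrm{cr}}]\,\}\cup\{pT\},$$ where $k$ counts the triggering times within the $p$-th period and $l$ is a positive integer, starting from $l=1$ in the first period and increasing afterwards. The sequence $\{t_k\}$ consists of the initial time $0$ (so that $u=K_\lambda x(0)$ until the first update) together with all the times $t^*_{k,p}$, $p\ge1$, in increasing order. *)

theory Defs
  imports "HOL-Analysis.Analysis" "HOL-Computational_Algebra.Polynomial"
begin

(* Vectors and matrices are indexed by a finite linearly ordered type 'n; "pos i" is the
   place of i in {1..n} with n = CARD('n), so that matrices can be given by row and column
   numbers starting at 1. *)

definition pos :: "'n::{finite,linorder} \<Rightarrow> nat" where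
  "pos i = card {j. j \<le> i}"

(* The raw vec type avoids repeating the sort of 'n, which the notation real^'n would
   otherwise constrain to finite only. *)

type_synonym 'n rvec = "(real, 'n) vec"
type_synonym 'n sq_mat = "((real, 'n) vec, 'n) vec"

definition matrix_norm :: "real^'n^'m \<Rightarrow> real" where
  "matrix_norm M = onorm ((*v) M)"

definition ccf_A :: "(nat \<Rightarrow> real) \<Rightarrow> ('n::{finite,linorder}) sq_mat" where
  "ccf_A a = (\<chi> i j.
     if pos i < CARD('n) then (if pos j = pos i + 1 then 1 else 0)
     else - a (CARD('n) + 1 - pos j))"

definition ccf_B :: "real^1^'n::{finite,linorder}" where
  "ccf_B = (\<chi> i j. if pos i = CARD('n) then 1 else 0)"

(* The gain that turns the characteristic polynomial into (s + lam)^n. *)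

definition gain :: "(nat \<Rightarrow> real) \<Rightarrow> real \<Rightarrow> real^'n::{finite,linorder}^1" where
  "gain a lam = (\<chi> i j. let m = CARD('n) + 1 - pos j in
     - (real (CARD('n) choose m) * lam ^ m) + a m)"

definition shift_N :: "('n::{finite,linorder}) sq_mat" where
  "shift_N = (\<chi> i j. if pos j = pos i + 1 then 1 else 0)"

definition jordan_J :: "real \<Rightarrow> ('n::{finite,linorder}) sq_mat" where
  "jordan_J lam = - (lam *\<^sub>R mat 1) + shift_N"

definition rational_on_pos :: "(real \<Rightarrow> real) \<Rightarrow> bool" where
  "rational_on_pos f \<longleftrightarrow>
     (\<exists>p q :: real poly. \<forall>lam>0. poly q lam \<noteq> 0 \<and> f lam = poly p lam / poly q lam)"

(* Tm lam is the transformation matrix T_lam; the equation says that its columns are a Jordan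
   chain of the closed-loop matrix. *)

definition jordan_transform ::
  "(nat \<Rightarrow> real) \<Rightarrow> (real \<Rightarrow> ('n::{finite,linorder}) sq_mat) \<Rightarrow> bool" where
  "jordan_transform a Tm \<longleftrightarrow>
     (\<forall>lam>0. invertible (Tm lam) \<and>
        ccf_A a + ccf_B ** gain a lam = Tm lam ** jordan_J lam ** matrix_inv (Tm lam)) \<and>
     (\<forall>i j. rational_on_pos (\<lambda>lam. Tm lam $ i $ j) \<and>
            rational_on_pos (\<lambda>lam. matrix_inv (Tm lam) $ i $ j))"

(* A system is represented by the set of its solutions on {0..}, given as a predicate.  All
   systems below are linear, so attractivity is required for every initial state. *)

definition lyapunov_stable :: "((real \<Rightarrow> 'a::real_normed_vector) \<Rightarrow> bool) \<Rightarrow> bool" where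
  "lyapunov_stable Sol \<longleftrightarrow>
     (\<forall>\<epsilon>>0. \<exists>\<delta>>0. \<forall>x. Sol x \<and> norm (x 0) < \<delta> \<longrightarrow> (\<forall>t\<ge>0. norm (x t) < \<epsilon>))"

definition asymptotically_stable :: "((real \<Rightarrow> 'a::real_normed_vector) \<Rightarrow> bool) \<Rightarrow> bool" where
  "asymptotically_stable Sol \<longleftrightarrow>
     lyapunov_stable Sol \<and> (\<forall>x. Sol x \<longrightarrow> (x \<longlongrightarrow> 0) at_top)"

definition linear_solution :: "real^'n^'n \<Rightarrow> (real \<Rightarrow> real^'n) \<Rightarrow> bool" where
  "linear_solution A x \<longleftrightarrow>
     (\<forall>t\<ge>0. (x has_vector_derivative A *v x t) (at t within {0..}))"

definition sampled_solution ::
  "real^'n^'n \<Rightarrow> real^'m^'n \<Rightarrow> real^'n^'m \<Rightarrow> (nat \<Rightarrow> real) \<Rightarrow> (real \<Rightarrow> real^'n) \<Rightarrow> bool" where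
  "sampled_solution A B K t x \<longleftrightarrow>
     continuous_on {0..} x \<and>
     (\<forall>k. \<forall>s\<in>{t k..<t (Suc k)}.
        (x has_vector_derivative A *v x s + B *v (K *v x (t k))) (at s within {t k..<t (Suc k)}))"

definition trigger_cond ::
  "(nat \<Rightarrow> real) \<Rightarrow> real \<Rightarrow> real \<Rightarrow> ('n::{finite,linorder}) sq_mat \<Rightarrow> 'n rvec \<Rightarrow> 'n rvec \<Rightarrow> bool" where
  "trigger_cond a \<sigma> lam M held y \<longleftrightarrow>
     (norm (matrix_inv M *v (held - y)))\<^sup>2
     \<le> \<sigma> * (2 * lam - 1 - 2 * matrix_norm (shift_N :: 'n sq_mat))
         / (matrix_norm (matrix_inv M ** (ccf_B ** gain a lam) ** M))\<^sup>2
         * (norm (matrix_inv M *v y))\<^sup>2"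

(* The first m triggering intervals of an event-triggered run x with triggering times
   t 0 = 0, t 1, ..., t m.  The motion z continues x from time t k on with the input held
   constant, and t (k+1) is the time at which the condition C would start to fail along z.
   If it never fails along z, then t k is the last triggering time; quantifying over m covers
   the runs with finitely many and with infinitely many triggering times. *)

definition event_run ::
  "real^'n^'n \<Rightarrow> real^'m^'n \<Rightarrow> real^'n^'m \<Rightarrow> (real^'n \<Rightarrow> real^'n \<Rightarrow> bool) \<Rightarrow>
   nat \<Rightarrow> (nat \<Rightarrow> real) \<Rightarrow> (real \<Rightarrow> real^'n) \<Rightarrow> bool" where
  "event_run A B K C m t x \<longleftrightarrow>
     t 0 = 0 \<and>
     (\<forall>k<m. \<exists>z.
        z (t k) = x (t k) \<and>
        (\<forall>s\<ge>t k. (z has_vector_derivative A *v z s + B *v (K *v x (t k))) (at s within {t k..})) \<and>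
        {s. s > t k \<and> \<not> C (x (t k)) (z s)} \<noteq> {} \<and>
        t (Suc k) = Inf {s. s > t k \<and> \<not> C (x (t k)) (z s)} \<and>
        (\<forall>s\<in>{t k..t (Suc k)}. x s = z s))"

definition inter_event_bound ::
  "(nat \<Rightarrow> real) \<Rightarrow> real \<Rightarrow> real \<Rightarrow> ('n::{finite,linorder}) sq_mat \<Rightarrow> real \<Rightarrow> bool" where
  "inter_event_bound a \<sigma> lam M \<tau> \<longleftrightarrow>
     \<tau> > 0 \<and>
     (\<forall>m t x. event_run (ccf_A a) ccf_B (gain a lam) (trigger_cond a \<sigma> lam M) m t x \<longrightarrow>
        (\<forall>k<m. t (Suc k) - t k \<ge> \<tau>))"

definition update_times :: "real \<Rightarrow> real \<Rightarrow> real \<Rightarrow> real set" where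
  "update_times Toff T \<tau> =
     {0} \<union> (\<Union>p\<in>{1::nat..}.
        {real l * \<tau> | l::nat. l \<ge> 1 \<and> real l * \<tau> \<in> {(real p - 1) * T .. (real p - 1) * T + Toff}}
        \<union> {real p * T})"

definition update_sequence :: "real \<Rightarrow> real \<Rightarrow> real \<Rightarrow> (nat \<Rightarrow> real) \<Rightarrow> bool" where
  "update_sequence Toff T \<tau> t \<longleftrightarrow> strict_mono t \<and> range t = update_times Toff T \<tau>"

lemma update_sequence_exists:
  assumes "0 < T" "0 < \<tau>"
  shows "\<exists>t. update_sequence Toff T \<tau> t"
proof -
  let ?S = "update_times Toff T \<tau>"
  define g where "g s = card (?S \<inter> {..<s})" for s
  have nonneg: "s \<ge> 0" if "s \<in> ?S" for s
    using that assms by (auto simp: update_times_def)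
  have fin: "finite (?S \<inter> {..<r})" for r
  proof -
    have "?S \<inter> {..<r} \<subseteq> (\<lambda>l. real l * \<tau>) ` {..nat \<lceil>r / \<tau>\<rceil>} \<union> (\<lambda>p. real p * T) ` {..nat \<lceil>r / T\<rceil>}"
    proof
      fix s assume s: "s \<in> ?S \<inter> {..<r}"
      have bd: "l \<le> nat \<lceil>r / c\<rceil>" if "real l * c < r" "c > 0" for l and c :: real
      proof -
        have "real l < r / c" using that by (simp add: field_simps)
        then show ?thesis by linarith
      qed
      from s consider "s = 0" | l where "s = real l * \<tau>" | p where "s = real p * T"
        by (auto simp: update_times_def)
      then show "s \<in> (\<lambda>l. real l * \<tau>) ` {..nat \<lceil>r / \<tau>\<rceil>} \<union> (\<lambda>p. real p * T) ` {..nat \<lceil>r / T\<rceil>}"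
      proof cases
        case 1 then show ?thesis by (auto intro!: image_eqI[of _ _ "0::nat"])
      next
        case 2 then show ?thesis using s bd[of _ \<tau>] assms by auto
      next
        case 3 then show ?thesis using s bd[of _ T] assms by auto
      qed
    qed
    then show ?thesis by (rule finite_subset) auto
  qed
  have g_less: "g s < g s'" if "s \<in> ?S" "s < s'" for s s'
    unfolding g_def using that by (intro psubset_card_mono fin) auto
  have "range (\<lambda>p. real (Suc p) * T) \<subseteq> ?S"
    by (force simp: update_times_def)
  moreover have "inj (\<lambda>p. real (Suc p) * T)"
    using assms by (auto intro: injI)
  ultimately have inf: "infinite ?S"
    by (meson finite_subset range_inj_infinite)
  have surj: "\<exists>s\<in>?S. g s = k" for k
  proof (induction k)
    case 0
    have "?S \<inter> {..<0} = {}" using nonneg by force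
    then show ?case by (intro bexI[of _ 0]) (auto simp: g_def update_times_def)
  next
    case (Suc k)
    then obtain s where s: "s \<in> ?S" "g s = k" by auto
    have "?S \<inter> {s<..} \<noteq> {}"
    proof
      assume "?S \<inter> {s<..} = {}"
      then have "?S \<subseteq> ?S \<inter> {..<s + 1}" by force
      then show False using inf fin finite_subset by blast
    qed
    then obtain r where r: "r \<in> ?S" "r > s" by auto
    let ?F = "?S \<inter> {s<..<r + 1}"
    have F: "finite ?F" by (rule finite_subset[OF _ fin[of "r + 1"]]) auto
    define m where "m = Min ?F"
    have "?F \<noteq> {}" using r by auto
    then have m: "m \<in> ?F"
      unfolding m_def by (rule Min_in[OF F])
    have m_le: "m \<le> v" if "v \<in> ?F" for v
      unfolding m_def using F that by (rule Min_le)
    have "?S \<inter> {..<m} = insert s (?S \<inter> {..<s})"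
      using m m_le s by force
    then have "g m = Suc k" using s fin by (simp add: g_def)
    then show ?case using m by auto
  qed
  define t where "t k = (SOME s. s \<in> ?S \<and> g s = k)" for k
  have t: "t k \<in> ?S" "g (t k) = k" for k
    using someI_ex[of "\<lambda>s. s \<in> ?S \<and> g s = k"] surj[of k] unfolding t_def by auto
  have "strict_mono t"
  proof (rule strict_monoI)
    fix i j :: nat assume "i < j"
    then have "\<not> t j < t i" "t i \<noteq> t j"
      using g_less[OF t(1), of j "t i"] t(2) by (metis not_less_iff_gr_or_eq, metis less_irrefl)
    then show "t i < t j" by simp
  qed
  moreover have "range t = ?S"
  proof -
    have "s = t (g s)" if "s \<in> ?S" for s
      by (metis g_less less_irrefl linorder_neqE t that)
    then show ?thesis using t by blast
  qed
  ultimately show ?thesis by (auto simp: update_sequence_def)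
qed

end

theory Submission
  imports Defs "HOL-Real_Asymp.Real_Asymp"
begin

text \<open>
  Put \<open>y = matrix_inv M *v x\<close> with \<open>M = Tm lam\<close>. While the jammer sleeps, less than \<open>\<tau>\<close> has
  passed since the last update, so the triggering condition holds and the squared norm of \<open>y\<close>
  decays at rate \<open>(1 - \<sigma>) * (2 * lam - 1 - 2 * nu)\<close>, where \<open>nu\<close> is the norm of \<open>shift_N\<close>. At the
  end of the sleeping window the triggering condition also bounds the held input by a multiple of
  the norm of \<open>y\<close> that depends polynomially on \<open>lam\<close> and on the norm of \<open>M\<close>. During the jammed
  part of the period the state follows the open loop with this constant input, whose growth
  exponent does not depend on \<open>lam\<close>. Over one period the squared norm of \<open>y\<close> is therefore
  multiplied by at most a subexponential function of \<open>lam\<close> (the entries of \<open>M\<close> and of its inverse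
  are rational) times \<open>exp (- c * lam)\<close> with \<open>c > 0\<close>, which is below \<open>1/2\<close> for all large \<open>lam\<close>.
\<close>

section \<open>Affine differential equations\<close>

text \<open>Differential form of Gronwall's inequality: \<open>f s * exp (- c * s)\<close> is
  nonincreasing. The sign of \<open>c\<close> is free, so the same estimate gives decay under fresh
  data and growth under jamming. The derivative is taken only inside the interval because sampled
  solutions may have kinks at the update times.\<close>

lemma exp_growth_bound:
  fixes f :: "real \<Rightarrow> real"
  assumes "a \<le> b" "continuous_on {a..b} f"
    and "\<And>s. a < s \<Longrightarrow> s < b \<Longrightarrow> \<exists>D. (f has_real_derivative D) (at s) \<and> D \<le> c * f s"
  shows "f b \<le> f a * exp (c * (b - a))"
proof (cases "a = b")
  case False
  then have "a < b" using assms(1) by simp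
  let ?g = "\<lambda>s. f s * exp (- c * s)"
  have "?g b \<le> ?g a"
  proof (rule DERIV_nonpos_imp_decreasing_open[OF assms(1)])
    fix s assume s: "a < s" "s < b"
    then obtain D where D: "(f has_real_derivative D) (at s)" "D \<le> c * f s"
      using assms(3) by blast
    have "(?g has_real_derivative (D - c * f s) * exp (- c * s)) (at s)"
      by (rule derivative_eq_intros D(1) refl | simp add: algebra_simps)+
    moreover have "(D - c * f s) * exp (- c * s) \<le> 0"
      using D(2) by (simp add: mult_nonpos_nonneg)
    ultimately show "\<exists>y. (?g has_real_derivative y) (at s) \<and> y \<le> 0" by blast
  qed (intro continuous_intros assms(2))
  then have "?g b * exp (c * b) \<le> ?g a * exp (c * b)"
    by (simp add: mult_right_mono)
  moreover have "?g b * exp (c * b) = f b" "?g a * exp (c * b) = f a * exp (c * (b - a))"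
    by (simp_all add: mult.assoc right_diff_distrib flip: exp_add)
  ultimately show ?thesis by (simp only:)
qed simp

lemma has_real_derivative_norm_square:
  fixes x :: "real \<Rightarrow> 'a::real_inner"
  assumes "(x has_vector_derivative v) (at s)"
  shows "((\<lambda>s. (norm (x s))\<^sup>2) has_real_derivative 2 * (x s \<bullet> v)) (at s)"
proof -
  have "((\<lambda>s. x s \<bullet> x s) has_derivative (\<lambda>h. x s \<bullet> (h *\<^sub>R v) + (h *\<^sub>R v) \<bullet> x s)) (at s)"
    using assms[unfolded has_vector_derivative_def]
    by (rule has_derivative_inner[OF _ assms[unfolded has_vector_derivative_def]])
  moreover have "(\<lambda>h. x s \<bullet> (h *\<^sub>R v) + (h *\<^sub>R v) \<bullet> x s) = (*) (2 * (x s \<bullet> v))"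
    by (auto simp: inner_commute algebra_simps)
  ultimately show ?thesis
    by (simp add: has_field_derivative_def power2_norm_eq_inner)
qed

lemma norm_matrix_vector_le: "norm (M *v x) \<le> matrix_norm M * norm x"
  for M :: "real^'n^'m"
  unfolding matrix_norm_def
  by (rule onorm[OF matrix_vector_mul_bounded_linear])

lemma matrix_norm_nonneg: "0 \<le> matrix_norm M" for M :: "real^'n^'m"
  unfolding matrix_norm_def
  by (rule onorm_pos_le[OF matrix_vector_mul_bounded_linear])

text \<open>Adding the constant \<open>(norm w)\<^sup>2\<close> to the squared norm makes the
  differential inequality homogeneous, since 2 \<open>x s \<bullet> w\<close> is at most the sum of
  the two squares. The growth exponent then depends on \<open>A\<close> alone and not on the held
  input \<open>w\<close>.\<close>

lemma affine_ode_growth: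
  fixes A :: "real^'n^'n" and x :: "real \<Rightarrow> real^'n"
  assumes "b \<le> c" "continuous_on {b..c} x"
    and "\<And>s. b < s \<Longrightarrow> s < c \<Longrightarrow> (x has_vector_derivative A *v x s + w) (at s)"
  shows "(norm (x c))\<^sup>2 + (norm w)\<^sup>2
    \<le> ((norm (x b))\<^sup>2 + (norm w)\<^sup>2) * exp ((2 * matrix_norm A + 1) * (c - b))"
proof (rule exp_growth_bound[OF assms(1), where f = "\<lambda>s. (norm (x s))\<^sup>2 + (norm w)\<^sup>2"])
  show "continuous_on {b..c} (\<lambda>s. (norm (x s))\<^sup>2 + (norm w)\<^sup>2)"
    by (intro continuous_intros assms(2))
next
  fix s assume s: "b < s" "s < c"
  have "((\<lambda>s. (norm (x s))\<^sup>2 + (norm w)\<^sup>2) has_real_derivative 2 * (x s \<bullet> (A *v x s + w)) + 0) (at s)"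
    by (intro DERIV_add DERIV_const has_real_derivative_norm_square assms(3) s)
  moreover have "2 * (x s \<bullet> (A *v x s + w)) + 0
    \<le> (2 * matrix_norm A + 1) * ((norm (x s))\<^sup>2 + (norm w)\<^sup>2)"
  proof -
    have "x s \<bullet> (A *v x s) \<le> norm (x s) * norm (A *v x s)" by (rule norm_cauchy_schwarz)
    also have "\<dots> \<le> norm (x s) * (matrix_norm A * norm (x s))"
      by (intro mult_left_mono norm_matrix_vector_le) auto
    finally have 1: "x s \<bullet> (A *v x s) \<le> matrix_norm A * (norm (x s))\<^sup>2"
      by (simp add: power2_eq_square algebra_simps)
    have 2: "2 * (x s \<bullet> w) \<le> (norm (x s))\<^sup>2 + (norm w)\<^sup>2"
      using norm_cauchy_schwarz[of "x s" w] sum_squares_bound[of "norm (x s)" "norm w"] by linarith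
    have "0 \<le> matrix_norm A * (norm w)\<^sup>2"
      by (simp add: matrix_norm_nonneg)
    then show ?thesis using 1 2 by (simp add: algebra_simps)
  qed
  ultimately show "\<exists>D. ((\<lambda>s. (norm (x s))\<^sup>2 + (norm w)\<^sup>2) has_real_derivative D) (at s)
      \<and> D \<le> (2 * matrix_norm A + 1) * ((norm (x s))\<^sup>2 + (norm w)\<^sup>2)"
    by blast
qed

text \<open>The difference of two solutions solves the equation with zero input, and the growth
  estimate keeps it at zero.\<close>

lemma affine_ode_unique:
  fixes A :: "real^'n^'n" and x z :: "real \<Rightarrow> real^'n"
  assumes "b \<le> c" "continuous_on {b..c} x" "continuous_on {b..c} z" "x b = z b"
    and "\<And>s. b < s \<Longrightarrow> s < c \<Longrightarrow> (x has_vector_derivative A *v x s + w) (at s)"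
    and "\<And>s. b < s \<Longrightarrow> s < c \<Longrightarrow> (z has_vector_derivative A *v z s + w) (at s)"
  shows "x c = z c"
proof -
  have "(norm (x c - z c))\<^sup>2 + (norm (0::real^'n))\<^sup>2
    \<le> ((norm (x b - z b))\<^sup>2 + (norm (0::real^'n))\<^sup>2) * exp ((2 * matrix_norm A + 1) * (c - b))"
  proof (rule affine_ode_growth[OF assms(1), where x = "\<lambda>s. x s - z s"])
    show "continuous_on {b..c} (\<lambda>s. x s - z s)"
      by (intro continuous_intros assms)
    fix s assume "b < s" "s < c"
    then show "((\<lambda>s. x s - z s) has_vector_derivative A *v (x s - z s) + 0) (at s)"
      using has_vector_derivative_diff[OF assms(5,6), of s]
      by (simp add: matrix_vector_mult_diff_distrib)
  qed
  then show ?thesis using assms(4) by simp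
qed

text \<open>An event-triggered run asks for a motion that continues for all later times with the
  input held, whereas a sampled solution follows that equation only up to its next update. The
  continuation is built as an entrywise power series.\<close>

lemma affine_ode_exists:
  fixes A :: "real^'n^'n" and x0 w :: "real^'n"
  obtains z where "z 0 = x0" "\<And>s. (z has_vector_derivative A *v z s + w) (at s)"
proof -
  \<comment> \<open>\<open>v n\<close> is the n-th derivative of the solution at 0; the constant
    input enters only the first one.\<close>
  define v where "v = rec_nat x0 (\<lambda>n u. A *v u + (if n = 0 then w else 0))"
  have v0: "v 0 = x0" and vS: "v (Suc n) = A *v v n + (if n = 0 then w else 0)" for n
    by (simp_all add: v_def)
  define c where "c i n = v n $ i / fact n" for i n
  \<comment> \<open>The summand 1 leaves room in the induction for the contribution of
    \<open>w\<close>.\<close>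
  define L where "L = matrix_norm A + 1"
  have L: "L \<ge> 1" by (simp add: L_def matrix_norm_nonneg)
  have v_le: "norm (v n) \<le> (norm x0 + norm w) * L ^ n" for n
  proof (induction n)
    case (Suc n)
    have "norm (v (Suc n)) \<le> matrix_norm A * norm (v n) + (if n = 0 then norm w else 0)"
      unfolding vS using norm_triangle_ineq norm_matrix_vector_le
      by (smt (verit) norm_zero)
    also have "\<dots> \<le> matrix_norm A * ((norm x0 + norm w) * L ^ n) + (norm x0 + norm w) * L ^ n"
    proof (intro add_mono mult_left_mono Suc matrix_norm_nonneg)
      show "(if n = 0 then norm w else 0) \<le> (norm x0 + norm w) * L ^ n"
        using L by simp
    qed
    finally show ?case by (simp add: L_def algebra_simps)
  qed (simp add: v0)
  have summ: "summable (\<lambda>n. c i n * y ^ n)" for i y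
  proof (rule summable_comparison_test')
    show "summable (\<lambda>n. (norm x0 + norm w) * (inverse (fact n) * (L * \<bar>y\<bar>) ^ n))"
      by (intro summable_mult summable_exp)
    fix n
    have "norm (c i n * y ^ n) = \<bar>v n $ i\<bar> * \<bar>y\<bar> ^ n / fact n"
      by (simp add: c_def abs_mult power_abs)
    also have "\<dots> \<le> ((norm x0 + norm w) * L ^ n) * \<bar>y\<bar> ^ n / fact n"
      by (intro divide_right_mono mult_right_mono order_trans[OF component_le_norm_cart v_le]) auto
    finally show "norm (c i n * y ^ n) \<le> (norm x0 + norm w) * (inverse (fact n) * (L * \<bar>y\<bar>) ^ n)"
      by (simp add: power_mult_distrib field_simps)
  qed
  define z :: "real \<Rightarrow> real^'n" where "z s = (\<chi> i. \<Sum>n. c i n * s ^ n)" for s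
  have "z 0 = x0"
    by (simp add: z_def powser_zero vec_eq_iff) (simp add: c_def v0)
  moreover have "(z has_vector_derivative A *v z s + w) (at s)" for s
  proof -
    have eq: "(\<Sum>n. diffs (c i) n * s ^ n) = (A *v z s + w) $ i" for i
    proof -
      have "diffs (c i) n * s ^ n = (\<Sum>j\<in>UNIV. A $ i $ j * (c j n * s ^ n)) + (if n = 0 then w $ i else 0)" for n
      proof -
        have "diffs (c i) n = v (Suc n) $ i / fact n"
          by (simp add: diffs_def c_def field_simps del: of_nat_Suc)
        also have "\<dots> = (\<Sum>j\<in>UNIV. A $ i $ j * c j n) + (if n = 0 then w $ i else 0)"
          by (simp add: vS c_def matrix_vector_mult_def sum_divide_distrib)
        finally show ?thesis
          by (simp add: sum_distrib_left algebra_simps)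
      qed
      moreover have "(\<lambda>n. (\<Sum>j\<in>UNIV. A $ i $ j * (c j n * s ^ n)) + (if n = 0 then w $ i else 0))
          sums ((\<Sum>j\<in>UNIV. A $ i $ j * (\<Sum>n. c j n * s ^ n)) + w $ i)"
        by (intro sums_add sums_sum sums_mult summable_sums summ) (rule sums_single)
      ultimately show ?thesis
        by (simp add: sums_iff matrix_vector_mult_def z_def)
    qed
    have "((\<lambda>s. z s $ i) has_vector_derivative (A *v z s + w) $ i) (at s)" for i
      using termdiffs_strong_converges_everywhere[of "c i" s, OF summ] eq[of i]
      by (simp add: z_def has_real_derivative_iff_has_vector_derivative)
    then show ?thesis
      unfolding has_vector_derivative_def
      by (subst has_derivative_componentwise_within)
         (auto simp: Basis_vec_def inner_axis)
  qed
  ultimately show ?thesis using that by blast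
qed

section \<open>Update times and sampled solutions\<close>

lemma update_times_nonneg:
  assumes "u \<in> update_times Toff T \<tau>" "0 < T"
  shows "0 \<le> u"
proof -
  consider "u = 0" | q where "u = real q * T" | q where "q \<ge> (1::nat)" "(real q - 1) * T \<le> u"
    using assms(1) by (auto simp: update_times_def)
  then show ?thesis
  proof cases
    case 3
    then have "0 \<le> (real q - 1) * T" using assms(2) by simp
    then show ?thesis using 3 by linarith
  qed (use assms(2) in auto)
qed

lemma period_in_update_times: "real p * T \<in> update_times Toff T \<tau>"
  by (cases "p = 0") (auto simp: update_times_def)

text \<open>Periods are counted from 0 here and in what follows, but from 1 in
  \<open>update_times\<close>, hence the witness \<open>Suc p\<close>. The grid point with
  \<open>l = 0\<close> is the initial time.\<close>

lemma grid_in_update_times: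
  assumes "real p * T \<le> real l * \<tau>" "real l * \<tau> \<le> real p * T + Toff"
  shows "real l * \<tau> \<in> update_times Toff T \<tau>"
proof (cases "l = 0")
  case False
  then show ?thesis
    using assms unfolding update_times_def
    by (intro UnI2 UN_I[of "Suc p"] UnI1) auto
qed (simp add: update_times_def)

text \<open>Every update time is 0, a period end or a point of a sleeping window. One that lies
  strictly after the window of period \<open>p\<close> therefore belongs to a later window or is a
  later period end.\<close>

lemma no_update_while_jammed:
  assumes "u \<in> update_times Toff T \<tau>" "real p * T + Toff < u" "0 < T" "0 < Toff"
  shows "real (Suc p) * T \<le> u"
proof -
  consider "u = 0" | q where "u = real q * T"
    | q where "q \<ge> (1::nat)" "(real q - 1) * T \<le> u" "u \<le> (real q - 1) * T + Toff"
    using assms(1) by (auto simp: update_times_def)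
  then show ?thesis
  proof cases
    case 1
    moreover have "0 \<le> real p * T" using assms(3) by simp
    ultimately show ?thesis using assms(2,4) by linarith
  next
    case 2
    then have "real p * T < real q * T" using assms(2,4) by linarith
    then have "Suc p \<le> q" using assms(3) by simp
    then show ?thesis using 2 assms(3) by (simp add: mult_right_mono del: of_nat_Suc)
  next
    case 3
    then have "real p * T < (real q - 1) * T" using assms(2) by linarith
    then have "real (Suc p) < real q" using assms(3) by simp
    then have "real (Suc p) \<le> real q - 1" using of_nat_less_iff[of "Suc p" q, where ?'a = real] by linarith
    then have "real (Suc p) * T \<le> (real q - 1) * T" using assms(3) by (intro mult_right_mono) auto
    then show ?thesis using 3 by linarith
  qed
qed

lemma update_sequence_0:
  assumes "update_sequence Toff T \<tau> t" "0 < T"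
  shows "t 0 = 0"
proof -
  have r: "range t = update_times Toff T \<tau>" and m: "strict_mono t"
    using assms(1) by (simp_all add: update_sequence_def)
  have "0 \<in> range t" unfolding r by (simp add: update_times_def)
  then obtain k where "t k = 0" by auto
  moreover have "t 0 \<le> t k"
    using m by (simp add: strict_mono_less_eq)
  moreover have "0 \<le> t 0"
    using r assms(2) by (intro update_times_nonneg[of _ Toff T \<tau>]) auto
  ultimately show ?thesis by simp
qed

lemma update_sequence_next_le:
  assumes "update_sequence Toff T \<tau> t" "u \<in> update_times Toff T \<tau>" "t k < u"
  shows "t (Suc k) \<le> u"
proof -
  have "strict_mono t" and "u \<in> range t"
    using assms(1,2) by (simp_all add: update_sequence_def)
  then show ?thesis
    using assms(3) by (auto simp: strict_mono_less strict_mono_less_eq)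
qed

text \<open>The period ends make the update times unbounded, so some index has its update after
  \<open>s\<close>; the least such index has a predecessor because \<open>t 0 = 0\<close>.\<close>

lemma update_sequence_bracket:
  assumes "update_sequence Toff T \<tau> t" "0 < T" "0 \<le> s"
  obtains k where "t k \<le> s" "s < t (Suc k)"
proof -
  obtain p where "s < real p * T" using reals_Archimedean3[OF assms(2)] by blast
  moreover obtain j where "t j = real p * T"
    using assms(1) period_in_update_times[of p T Toff \<tau>] by (metis update_sequence_def imageE)
  ultimately have ex: "s < t j" by simp
  define m where "m = (LEAST k. s < t k)"
  have "s < t m" using ex unfolding m_def by (rule LeastI)
  moreover then obtain k where "m = Suc k"
    using update_sequence_0[OF assms(1,2)] assms(3) by (cases m) auto
  moreover then have "\<not> s < t k" unfolding m_def by (metis lessI not_less_Least)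
  ultimately show ?thesis using that by force
qed

text \<open>If no grid point of the current sleeping window has passed yet, then the update at the end
  of the previous period is the recent one; hence no relation between \<open>\<tau>\<close> and \<open>Toff\<close>
  is required.\<close>

lemma last_update_recent:
  assumes t: "update_sequence Toff T \<tau> t" and pos: "0 < T" "0 < \<tau>"
    and s: "real p * T \<le> s" "s \<le> real p * T + Toff" and k: "t k \<le> s" "s < t (Suc k)"
  shows "real p * T \<le> t k" "s - t k < \<tau>"
proof -
  have last: "u \<le> t k" if "u \<in> update_times Toff T \<tau>" "u \<le> s" for u
    using update_sequence_next_le[OF t that(1)] that(2) k by (metis not_le order_less_le_trans)
  show p: "real p * T \<le> t k"
    by (rule last[OF period_in_update_times s(1)])
  have "0 \<le> s" using s(1) pos(1) by (meson mult_nonneg_nonneg of_nat_0_le_iff less_imp_le order_trans)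
  define l where "l = nat \<lfloor>s / \<tau>\<rfloor>"
  have "real l \<le> s / \<tau>" "s / \<tau> < real l + 1"
    using \<open>0 \<le> s\<close> pos(2) by (simp_all add: l_def)
  then have l: "real l * \<tau> \<le> s" "s < real l * \<tau> + \<tau>"
    using pos(2) by (simp_all add: field_simps)
  show "s - t k < \<tau>"
  proof (cases "real p * T \<le> real l * \<tau>")
    case True
    then have "real l * \<tau> \<le> t k"
      using l s by (intro last grid_in_update_times) auto
    then show ?thesis using l by linarith
  next
    case False
    then show ?thesis using l p by linarith
  qed
qed

section \<open>Sampled solutions between two consecutive updates\<close>

lemma sampled_solution_deriv:
  assumes "sampled_solution A B K t x" "t k < s" "s < t (Suc k)"
  shows "(x has_vector_derivative A *v x s + (B ** K) *v x (t k)) (at s)"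
proof -
  have "(x has_vector_derivative A *v x s + B *v (K *v x (t k))) (at s within {t k..<t (Suc k)})"
    using assms by (auto simp: sampled_solution_def)
  moreover have "at s within {t k..<t (Suc k)} = at s"
    using assms by (intro at_within_interior) auto
  ultimately show ?thesis by (simp add: matrix_vector_mul_assoc)
qed

text \<open>The bound \<open>\<tau>\<close> speaks of event-triggered runs that start at time 0. By
  time invariance, a violation less than \<open>\<tau>\<close> after the update at \<open>b\<close>
  would produce such a run, started in \<open>x b\<close>, whose first interval is shorter than
  \<open>\<tau>\<close>.\<close>

lemma trigger_cond_until_bound:
  fixes M :: "('n::{finite,linorder}) sq_mat" and x :: "real \<Rightarrow> 'n rvec"
  assumes bound: "inter_event_bound a \<sigma> lam M \<tau>"
    and s: "b < s" "s - b < \<tau>"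
    and x: "continuous_on {b..s} x"
      "\<And>u. b < u \<Longrightarrow> u < s \<Longrightarrow>
        (x has_vector_derivative ccf_A a *v x u + (ccf_B ** gain a lam) *v x b) (at u)"
  shows "trigger_cond a \<sigma> lam M (x b) (x s)"
proof (rule ccontr)
  assume viol: "\<not> trigger_cond a \<sigma> lam M (x b) (x s)"
  obtain z where z: "z 0 = x b"
    "\<And>u. (z has_vector_derivative ccf_A a *v z u + (ccf_B ** gain a lam) *v x b) (at u)"
    using affine_ode_exists by blast
  have shift: "((\<lambda>u. z (u - b)) has_vector_derivative ccf_A a *v z (u - b) + (ccf_B ** gain a lam) *v x b) (at u)" for u
  proof -
    have "((\<lambda>u. u - b) has_vector_derivative 1) (at u)"
      by (auto intro!: derivative_eq_intros)
    from vector_diff_chain_at[OF this z(2)] show ?thesis by (simp add: o_def)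
  qed
  have eq: "x s = z (s - b)"
    using s(1) x z(1) shift
    by (intro affine_ode_unique[where z = "\<lambda>u. z (u - b)" and b = b and c = s and x = x])
       (auto intro!: continuous_at_imp_continuous_on has_vector_derivative_continuous)
  let ?V = "{u. u > 0 \<and> \<not> trigger_cond a \<sigma> lam M (x b) (z u)}"
  \<comment> \<open>The run consists of a single interval, so only \<open>t 0\<close> and
    \<open>t 1\<close> matter; later values merely repeat \<open>t 1\<close>.\<close>
  define t where "t k = (if k = 0 then 0 else Inf ?V)" for k :: nat
  have V: "s - b \<in> ?V" using viol eq s by simp
  have "event_run (ccf_A a) ccf_B (gain a lam) (trigger_cond a \<sigma> lam M) 1 t z"
    unfolding event_run_def
  proof (intro conjI allI impI exI[of _ z] ballI)
    fix k :: nat assume "k < 1"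
    then have k: "k = 0" by simp
    show "(z has_vector_derivative ccf_A a *v z u + ccf_B *v (gain a lam *v z (t k))) (at u within {t k..})" for u
      using z by (simp add: k t_def matrix_vector_mul_assoc has_vector_derivative_at_within)
    show "{s. t k < s \<and> \<not> trigger_cond a \<sigma> lam M (z (t k)) (z s)} \<noteq> {}"
      using V by (auto simp: k t_def z intro!: exI[of _ "s - b"])
    show "t (Suc k) = Inf {s. t k < s \<and> \<not> trigger_cond a \<sigma> lam M (z (t k)) (z s)}"
      by (simp add: k t_def z)
  qed (simp_all add: t_def)
  then have "\<tau> \<le> Inf ?V"
    using bound unfolding inter_event_bound_def by (fastforce simp: t_def)
  also have "\<dots> \<le> s - b"
    by (rule cInf_lower[OF V]) (auto intro!: bdd_belowI[of _ 0])
  finally show False using s by simp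
qed

section \<open>Geometric decay and subexponential functions\<close>

text \<open>The exponent counts the completed periods. Bounding the power by 1 gives stability, and
  its convergence to 0 gives attractivity.\<close>

lemma asymptotically_stable_geometric:
  assumes "0 < T" "0 \<le> C"
    and decay: "\<And>x s. Sol x \<Longrightarrow> 0 \<le> s \<Longrightarrow> (norm (x s))\<^sup>2 \<le> C * (1/2) ^ nat \<lfloor>s / T\<rfloor> * (norm (x 0))\<^sup>2"
  shows "asymptotically_stable Sol"
  unfolding asymptotically_stable_def lyapunov_stable_def
proof (intro conjI allI impI)
  fix \<epsilon> :: real assume \<epsilon>: "\<epsilon> > 0"
  \<comment> \<open>Using \<open>C + 1\<close> instead of \<open>C\<close> keeps the divisor
    positive when \<open>C = 0\<close> and makes the final inequality strict.\<close>
  define \<delta> where "\<delta> = \<epsilon> / sqrt (C + 1)"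
  have \<delta>: "\<delta> > 0" "(C + 1) * \<delta>\<^sup>2 = \<epsilon>\<^sup>2"
    using \<epsilon> assms(2) by (simp_all add: \<delta>_def power_divide)
  have "norm (x s) < \<epsilon>" if "Sol x" "norm (x 0) < \<delta>" "0 \<le> s" for x s
  proof -
    have "C * (1/2) ^ nat \<lfloor>s / T\<rfloor> \<le> C * 1"
      using assms(2) by (intro mult_left_mono power_le_one) auto
    then have "(norm (x s))\<^sup>2 \<le> C * (norm (x 0))\<^sup>2"
      by (intro order_trans[OF decay[OF that(1,3)]] mult_right_mono) auto
    also have "\<dots> \<le> C * \<delta>\<^sup>2"
      using that(2) assms(2) by (intro mult_left_mono power_mono) auto
    also have "\<dots> < \<epsilon>\<^sup>2"
      using \<delta> by (simp add: algebra_simps flip: \<delta>(2))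
    finally show ?thesis using \<epsilon> by (simp add: power_less_imp_less_base)
  qed
  then show "\<exists>\<delta>>0. \<forall>x. Sol x \<and> norm (x 0) < \<delta> \<longrightarrow> (\<forall>t\<ge>0. norm (x t) < \<epsilon>)"
    using \<delta> by blast
next
  fix x assume x: "Sol x"
  have "filterlim (\<lambda>s. nat \<lfloor>s / T\<rfloor>) sequentially at_top"
    using assms(1)
    by (intro filterlim_compose[OF filterlim_nat_sequentially] filterlim_compose[OF filterlim_floor_sequentially]
        filterlim_at_top_mult_tendsto_pos) real_asymp
  then have "((\<lambda>s. (1/2::real) ^ nat \<lfloor>s / T\<rfloor>) \<longlongrightarrow> 0) at_top"
    by (rule filterlim_compose[rotated]) (simp add: LIMSEQ_power_zero)
  then have "((\<lambda>s. C * (1/2) ^ nat \<lfloor>s / T\<rfloor> * (norm (x 0))\<^sup>2) \<longlongrightarrow> C * 0 * (norm (x 0))\<^sup>2) at_top"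
    by (intro tendsto_intros)
  then have lim: "((\<lambda>s. C * (1/2) ^ nat \<lfloor>s / T\<rfloor> * (norm (x 0))\<^sup>2) \<longlongrightarrow> 0) at_top"
    by simp
  have "\<forall>\<^sub>F s in at_top. norm ((norm (x s))\<^sup>2) \<le> C * (1/2) ^ nat \<lfloor>s / T\<rfloor> * (norm (x 0))\<^sup>2"
    using eventually_ge_at_top[of 0] by eventually_elim (use decay[OF x] in simp)
  then have "((\<lambda>s. (norm (x s))\<^sup>2) \<longlongrightarrow> 0) at_top"
    using lim by (rule Lim_null_comparison)
  from tendsto_real_sqrt[OF this] show "(x \<longlongrightarrow> 0) at_top"
    by (simp add: tendsto_norm_zero_iff)
qed

text \<open>This class is closed under sums, products and domination, so the rational entries of the
  transformation can be absorbed without tracking degrees.\<close>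

definition subexponential :: "(real \<Rightarrow> real) \<Rightarrow> bool" where
  "subexponential f \<longleftrightarrow> (\<forall>c>0. ((\<lambda>s. f s * exp (- c * s)) \<longlongrightarrow> 0) at_top)"

lemma subexponential_add: "subexponential f \<Longrightarrow> subexponential g \<Longrightarrow> subexponential (\<lambda>s. f s + g s)"
  unfolding subexponential_def by (simp add: distrib_right tendsto_add_zero)

text \<open>The rate \<open>c\<close> is split into two halves, one for each factor.\<close>

lemma subexponential_mult:
  assumes "subexponential f" "subexponential g"
  shows "subexponential (\<lambda>s. f s * g s)"
  unfolding subexponential_def
proof (intro allI impI)
  fix c :: real assume "c > 0"
  then have c: "c / 2 > 0" by simp
  have f: "((\<lambda>s. f s * exp (- (c/2) * s)) \<longlongrightarrow> 0) at_top"
    using assms(1) c unfolding subexponential_def by blast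
  have g: "((\<lambda>s. g s * exp (- (c/2) * s)) \<longlongrightarrow> 0) at_top"
    using assms(2) c unfolding subexponential_def by blast
  have e: "exp (- c * s) = exp (- (c/2) * s) * exp (- (c/2) * s)" for s
    by (subst exp_add[symmetric], rule arg_cong[where f = exp]) simp
  show "((\<lambda>s. f s * g s * exp (- c * s)) \<longlongrightarrow> 0) at_top"
    using tendsto_mult_zero[OF f g] unfolding e by (simp only: ac_simps)
qed

lemma subexponential_const: "subexponential (\<lambda>_. k)"
  unfolding subexponential_def by (intro allI impI) real_asymp

lemma subexponential_ident: "subexponential (\<lambda>s. s)"
  unfolding subexponential_def by (intro allI impI) real_asymp

lemma subexponential_poly: "subexponential (poly p)"
proof (induction p)
  case (pCons c p)
  then show ?case
    by (simp add: subexponential_add subexponential_const subexponential_mult subexponential_ident)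
qed (simp add: subexponential_const)

lemma subexponential_mono:
  assumes "subexponential g" "\<And>s. s \<ge> s0 \<Longrightarrow> \<bar>f s\<bar> \<le> C * \<bar>g s\<bar>"
  shows "subexponential f"
  unfolding subexponential_def
proof (intro allI impI)
  fix c :: real assume "c > 0"
  then have g: "((\<lambda>s. g s * exp (- c * s)) \<longlongrightarrow> 0) at_top"
    using assms(1) by (simp add: subexponential_def)
  have "\<forall>\<^sub>F s in at_top. norm (f s * exp (- c * s)) \<le> norm (g s * exp (- c * s)) * C"
    using eventually_ge_at_top[of s0]
  proof eventually_elim
    case (elim s)
    then show ?case using mult_right_mono[OF assms(2), of s "exp (- c * s)"]
      by (simp add: abs_mult mult_ac)
  qed
  then show "((\<lambda>s. f s * exp (- c * s)) \<longlongrightarrow> 0) at_top"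
    by (rule tendsto_0_le[OF g])
qed

lemma subexponential_sum:
  "(\<And>i. i \<in> I \<Longrightarrow> subexponential (f i)) \<Longrightarrow> subexponential (\<lambda>s. \<Sum>i\<in>I. f i s)"
  by (induction I rule: infinite_finite_induct)
     (auto intro: subexponential_add subexponential_const)

text \<open>A polynomial with positive leading coefficient eventually stays at or above that
  coefficient; a negative one is treated through \<open>- q\<close>. With \<open>q\<close> as
  denominator, this bounds a rational function by a multiple of its numerator.\<close>

lemma poly_bounded_away_from_0:
  fixes q :: "real poly"
  assumes "q \<noteq> 0"
  obtains s0 where "\<And>s. s \<ge> s0 \<Longrightarrow> \<bar>lead_coeff q\<bar> \<le> \<bar>poly q s\<bar>"
proof (cases "lead_coeff q > 0")
  case True
  then show ?thesis using poly_pinfty_gt_lc[OF True] that by fastforce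
next
  case False
  moreover have "lead_coeff q \<noteq> 0" using assms by simp
  ultimately have "lead_coeff (- q) > 0" unfolding degree_minus coeff_minus by linarith
  then show ?thesis using poly_pinfty_gt_lc[of "- q"] that by fastforce
qed

lemma subexponential_rational:
  assumes "rational_on_pos f"
  shows "subexponential f"
proof -
  obtain p q where pq: "\<And>s. s > 0 \<Longrightarrow> poly q s \<noteq> 0 \<and> f s = poly p s / poly q s"
    using assms unfolding rational_on_pos_def by blast
  have "q \<noteq> 0" using pq[of 1] by auto
  obtain s0 where s0: "\<And>s. s \<ge> s0 \<Longrightarrow> \<bar>lead_coeff q\<bar> \<le> \<bar>poly q s\<bar>"
    using poly_bounded_away_from_0[OF \<open>q \<noteq> 0\<close>] by blast
  show ?thesis
  proof (rule subexponential_mono[OF subexponential_poly[of p]])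
    fix s assume s: "s \<ge> max s0 1"
    then have "\<bar>f s\<bar> = \<bar>poly p s\<bar> / \<bar>poly q s\<bar>" using pq[of s] by simp
    also have "\<dots> \<le> \<bar>poly p s\<bar> / \<bar>lead_coeff q\<bar>"
      using s s0[of s] pq[of s] \<open>q \<noteq> 0\<close> by (intro divide_left_mono mult_pos_pos) auto
    finally show "\<bar>f s\<bar> \<le> (1 / \<bar>lead_coeff q\<bar>) * \<bar>poly p s\<bar>" by simp
  qed
qed

text \<open>The induced norm is dominated by the sum of the absolute values of the entries, each of
  which is subexponential.\<close>

lemma subexponential_matrix_norm:
  fixes M :: "real \<Rightarrow> real^'n^'m"
  assumes "\<And>i j. rational_on_pos (\<lambda>s. M s $ i $ j)"
  shows "subexponential (\<lambda>s. matrix_norm (M s))"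
proof (rule subexponential_mono)
  show "subexponential (\<lambda>s. \<Sum>i\<in>UNIV. \<Sum>j\<in>UNIV. \<bar>M s $ i $ j\<bar>)"
    by (intro subexponential_sum subexponential_mono[OF subexponential_rational[OF assms], where C = 1]) auto
  show "\<bar>matrix_norm (M s)\<bar> \<le> 1 * \<bar>\<Sum>i\<in>UNIV. \<Sum>j\<in>UNIV. \<bar>M s $ i $ j\<bar>\<bar>" for s
    using onorm_le_matrix_component_sum[of "M s"] matrix_norm_nonneg[of "M s"]
    by (simp add: matrix_norm_def)
qed

section \<open>One period of the jammer\<close>

lemma matrix_inv_mult:
  fixes M :: "real^'n^'n"
  assumes "invertible M"
  shows "M ** matrix_inv M = mat 1" "matrix_inv M ** M = mat 1"
proof -
  have "M ** matrix_inv M = mat 1 \<and> matrix_inv M ** M = mat 1"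
    unfolding matrix_inv_def using assms unfolding invertible_def by (rule someI_ex)
  then show "M ** matrix_inv M = mat 1" "matrix_inv M ** M = mat 1" by auto
qed

text \<open>In the coordinates \<open>y\<close> the closed loop reads y' = J y + G e, with
  \<open>e\<close> the transformed sampling error, and the squared norm of \<open>y\<close> is a
  Lyapunov function. The three terms 2 (nu - lam), 1 and \<sigma> (2 lam - 1 - 2 nu) add up to the
  stated rate. The held input is recovered as the closed-loop velocity minus
  \<open>A *v xc\<close>.\<close>

lemma
  fixes A F M :: "('n::{finite,linorder}) sq_mat" and xc xk :: "'n rvec"
  defines "y \<equiv> matrix_inv M *v xc" and "G \<equiv> matrix_inv M ** F ** M"
    and "nu \<equiv> matrix_norm (shift_N :: 'n sq_mat)"
  assumes M: "invertible M" "A + F = M ** jordan_J lam ** matrix_inv M"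
    and trig: "(norm (matrix_inv M *v (xk - xc)))\<^sup>2
      \<le> \<sigma> * (2 * lam - 1 - 2 * nu) / (matrix_norm G)\<^sup>2 * (norm y)\<^sup>2"
    and \<sigma>: "0 < \<sigma>" "\<sigma> < 1" and lam: "nu + 1/2 < lam"
  shows lyapunov_decrease:
      "2 * (y \<bullet> (matrix_inv M *v (A *v xc + F *v xk))) \<le> - ((1 - \<sigma>) * (2 * lam - 1 - 2 * nu)) * (norm y)\<^sup>2"
    and held_input_bound:
      "norm (F *v xk) \<le> matrix_norm M * (3 * lam + 1 + nu + matrix_norm A) * norm y"
proof -
  define e where "e = matrix_inv M *v (xk - xc)"
  have MM: "M ** matrix_inv M = mat 1" "matrix_inv M ** M = mat 1"
    using M(1) by (simp_all add: matrix_inv_mult)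
  have xc: "xc = M *v y" and Me: "M *v e = xk - xc"
    by (simp_all add: y_def e_def matrix_vector_mul_assoc MM)
  have xk: "xk = xc + M *v e" using Me by simp
  have nu0: "0 \<le> nu" by (simp add: nu_def matrix_norm_nonneg)
  have J: "jordan_J lam *v v = - lam *\<^sub>R v + shift_N *v v" for v :: "'n rvec"
  proof -
    have "(lam *\<^sub>R (mat 1 :: 'n sq_mat)) *v v = lam *\<^sub>R v"
      by (simp add: scaleR_matrix_vector_assoc[symmetric])
    moreover have "jordan_J lam = shift_N - lam *\<^sub>R (mat 1 :: 'n sq_mat)"
      by (simp add: jordan_J_def)
    ultimately show ?thesis
      by (simp add: matrix_vector_mult_diff_rdistrib)
  qed
  have AF: "A *v xc + F *v xc = M *v (jordan_J lam *v y)"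
  proof -
    have "A *v xc + F *v xc = (M ** jordan_J lam ** matrix_inv M) *v xc"
      by (simp add: matrix_vector_mult_add_rdistrib flip: M(2))
    then show ?thesis by (simp add: y_def matrix_vector_mul_assoc matrix_mul_assoc)
  qed
  have FM: "F *v (M *v e) = M *v (G *v e)"
    by (simp add: G_def matrix_vector_mul_assoc matrix_mul_assoc MM)
  have Ge: "(norm (G *v e))\<^sup>2 \<le> \<sigma> * (2 * lam - 1 - 2 * nu) * (norm y)\<^sup>2"
  proof -
    have "(norm (G *v e))\<^sup>2 \<le> (matrix_norm G)\<^sup>2 * (norm e)\<^sup>2"
      using power_mono[OF norm_matrix_vector_le[of G e], of 2] by (simp add: power_mult_distrib)
    also have "\<dots> \<le> (matrix_norm G)\<^sup>2 * (\<sigma> * (2 * lam - 1 - 2 * nu) / (matrix_norm G)\<^sup>2 * (norm y)\<^sup>2)"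
      using trig by (intro mult_left_mono) (auto simp: e_def)
    \<comment> \<open>If \<open>matrix_norm G = 0\<close>, division by zero makes the quotient 0,
      and nonnegativity of the right-hand side is enough.\<close>
    also have "\<dots> \<le> \<sigma> * (2 * lam - 1 - 2 * nu) * (norm y)\<^sup>2"
      using \<sigma> lam by (cases "matrix_norm G = 0") auto
    finally show ?thesis .
  qed
  have dot: "y \<bullet> (jordan_J lam *v y) \<le> (nu - lam) * (norm y)\<^sup>2"
  proof -
    have "y \<bullet> (shift_N *v y) \<le> norm y * norm (shift_N *v y)" by (rule norm_cauchy_schwarz)
    also have "\<dots> \<le> norm y * (nu * norm y)"
      unfolding nu_def by (intro mult_left_mono norm_matrix_vector_le) auto
    finally show ?thesis
      by (simp add: J inner_add_right power2_norm_eq_inner[symmetric] power2_eq_square algebra_simps)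
  qed
  have "A *v xc + F *v xk = M *v (jordan_J lam *v y + G *v e)"
    using AF by (simp add: xk matrix_vector_right_distrib FM)
  then have "matrix_inv M *v (A *v xc + F *v xk) = jordan_J lam *v y + G *v e"
    by (simp add: matrix_vector_mul_assoc matrix_mul_assoc MM)
  \<comment> \<open>This use of Young's inequality is the source of the -1 in the rate
    \<open>2 * lam - 1 - 2 * nu\<close>.\<close>
  moreover have "2 * (y \<bullet> (G *v e)) \<le> (norm y)\<^sup>2 + (norm (G *v e))\<^sup>2"
    using norm_cauchy_schwarz[of y "G *v e"] sum_squares_bound[of "norm y" "norm (G *v e)"] by linarith
  ultimately show "2 * (y \<bullet> (matrix_inv M *v (A *v xc + F *v xk)))
      \<le> - ((1 - \<sigma>) * (2 * lam - 1 - 2 * nu)) * (norm y)\<^sup>2"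
    using dot Ge by (simp add: inner_add_right algebra_simps)
  \<comment> \<open>Replacing the square root of the triggering factor by the cruder
    \<open>1 + 2 * lam\<close> keeps the bound on the held input polynomial in
    \<open>lam\<close>.\<close>
  have Ge': "norm (G *v e) \<le> (1 + 2 * lam) * norm y"
  proof (rule power2_le_imp_le)
    have "\<sigma> * (2 * lam - 1 - 2 * nu) \<le> 1 * (2 * lam - 1 - 2 * nu)"
      using \<sigma> lam by (intro mult_right_mono) auto
    also have "\<dots> \<le> (1 + 2 * lam)\<^sup>2"
      using nu0 lam by (simp add: power2_eq_square algebra_simps)
    finally have "\<sigma> * (2 * lam - 1 - 2 * nu) * (norm y)\<^sup>2 \<le> (1 + 2 * lam)\<^sup>2 * (norm y)\<^sup>2"
      by (intro mult_right_mono) auto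
    then show "(norm (G *v e))\<^sup>2 \<le> ((1 + 2 * lam) * norm y)\<^sup>2"
      using Ge by (simp add: power_mult_distrib)
  qed (use nu0 lam in simp)
  have Jy: "norm (jordan_J lam *v y) \<le> (lam + nu) * norm y"
  proof -
    have "norm (jordan_J lam *v y) \<le> norm (- lam *\<^sub>R y) + norm (shift_N *v y)"
      unfolding J by (rule norm_triangle_ineq)
    also have "\<dots> \<le> lam * norm y + nu * norm y"
      using nu0 lam unfolding nu_def by (intro add_mono norm_matrix_vector_le) auto
    finally show ?thesis by (simp add: algebra_simps)
  qed
  \<comment> \<open>Subtracting the open loop from the closed loop avoids estimating the norm of \<open>G\<close>.\<close>
  have "F *v xk = M *v (jordan_J lam *v y + G *v e) - A *v (M *v y)"
    using \<open>A *v xc + F *v xk = _\<close> xc by (simp add: algebra_simps)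
  then have "norm (F *v xk) \<le> norm (M *v (jordan_J lam *v y + G *v e)) + norm (A *v (M *v y))"
    by (metis norm_triangle_ineq4)
  also have "\<dots> \<le> matrix_norm M * ((lam + nu) * norm y + (1 + 2 * lam) * norm y)
      + matrix_norm A * (matrix_norm M * norm y)"
    by (intro add_mono order_trans[OF norm_matrix_vector_le] mult_left_mono
        order_trans[OF norm_triangle_ineq] Jy Ge' matrix_norm_nonneg norm_matrix_vector_le)
  finally show "norm (F *v xk) \<le> matrix_norm M * (3 * lam + 1 + nu + matrix_norm A) * norm y"
    by (simp add: algebra_simps)
qed

text \<open>In a sleeping window the last update is always less than \<open>\<tau>\<close> old, so
  the triggering condition holds throughout and the decay estimates between updates can be chained.
  The jammed stretch lies between two consecutive updates, so the open loop runs with one constant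
  input, which is bounded by the state at the end of the window.\<close>

lemma
  fixes M :: "('n::{finite,linorder}) sq_mat" and x :: "real \<Rightarrow> 'n rvec"
    and a :: "nat \<Rightarrow> real" and lam :: real
  defines "y \<equiv> \<lambda>s. matrix_inv M *v x s"
    and "A \<equiv> ccf_A a :: 'n sq_mat" and "F \<equiv> ccf_B ** gain a lam :: 'n sq_mat"
    and "nu \<equiv> matrix_norm (shift_N :: 'n sq_mat)"
  assumes sol: "sampled_solution (ccf_A a) ccf_B (gain a lam) t x"
    and t: "update_sequence Toff T \<tau> t"
    and jammer: "0 < Toff" "Toff < T"
    and bound: "inter_event_bound a \<sigma> lam M \<tau>"
    and M: "invertible M" "A + F = M ** jordan_J lam ** matrix_inv M"
    and \<sigma>: "0 < \<sigma>" "\<sigma> < 1" and lam: "nu + 1/2 < lam"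
  shows decay_while_sleeping: "\<And>s. real p * T \<le> s \<Longrightarrow> s \<le> real p * T + Toff \<Longrightarrow>
      (norm (y s))\<^sup>2 \<le> (norm (y (real p * T)))\<^sup>2 *
        exp (- ((1 - \<sigma>) * (2 * lam - 1 - 2 * nu)) * (s - real p * T))"
    and growth_while_jammed: "\<And>s. real p * T + Toff \<le> s \<Longrightarrow> s \<le> real (Suc p) * T \<Longrightarrow>
      (norm (x s))\<^sup>2 \<le> exp ((2 * matrix_norm A + 1) * T) * (matrix_norm M)\<^sup>2 *
        (1 + (3 * lam + 1 + nu + matrix_norm A)\<^sup>2) * (norm (y (real p * T + Toff)))\<^sup>2"
proof -
  have T: "0 < T" using jammer by simp
  have \<tau>: "0 < \<tau>" using bound by (simp add: inter_event_bound_def)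
  let ?b = "real p * T" let ?c = "real p * T + Toff"
  let ?r = "(1 - \<sigma>) * (2 * lam - 1 - 2 * nu)"
  have b0: "0 \<le> ?b" using T by simp
  have mono: "strict_mono t" and range: "range t = update_times Toff T \<tau>"
    using t by (simp_all add: update_sequence_def)
  have cont: "continuous_on {s..s'} x" if "0 \<le> s" for s s'
    using sol that unfolding sampled_solution_def by (auto intro: continuous_on_subset)
  have deriv: "(x has_vector_derivative A *v x s + F *v x (t k)) (at s)" if "t k < s" "s < t (Suc k)" for s k
    using sampled_solution_deriv[OF sol that] by (simp add: A_def F_def)
  have t0: "0 \<le> t k" for k
    using range T by (intro update_times_nonneg[of _ Toff T \<tau>]) auto
  have trig: "(norm (matrix_inv M *v (x (t k) - x s)))\<^sup>2
      \<le> \<sigma> * (2 * lam - 1 - 2 * nu) / (matrix_norm (matrix_inv M ** F ** M))\<^sup>2 * (norm (matrix_inv M *v x s))\<^sup>2"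
    if "t k \<le> s" "s < t (Suc k)" "?b \<le> s" "s \<le> ?c" for s k
  proof (cases "t k = s")
    \<comment> \<open>At an update instant the sampling error is zero.\<close>
    case True
    then show ?thesis using \<sigma> lam by simp
  next
    case False
    then have "trigger_cond a \<sigma> lam M (x (t k)) (x s)"
      using that last_update_recent(2)[OF t T \<tau> that(3,4,1,2)] deriv[unfolded A_def F_def]
      by (intro trigger_cond_until_bound[OF bound _ _ cont[OF t0]]) auto
    then show ?thesis by (simp add: trigger_cond_def nu_def F_def)
  qed
  have step: "(norm (y s'))\<^sup>2 \<le> (norm (y s))\<^sup>2 * exp (- ?r * (s' - s))"
    if "t k \<le> s" "s \<le> s'" "s' \<le> t (Suc k)" "?b \<le> s" "s' \<le> ?c" for s s' k
  proof (rule exp_growth_bound[OF that(2)])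
    show "continuous_on {s..s'} (\<lambda>s. (norm (y s))\<^sup>2)"
      unfolding y_def using that b0 cont[of s s']
      by (intro continuous_intros bounded_linear.continuous_on[OF matrix_vector_mul_bounded_linear]) auto
    fix u assume u: "s < u" "u < s'"
    have "(y has_vector_derivative matrix_inv M *v (A *v x u + F *v x (t k))) (at u)"
      unfolding y_def using that u
      by (intro bounded_linear.has_vector_derivative[OF matrix_vector_mul_bounded_linear] deriv) auto
    from has_real_derivative_norm_square[OF this]
    show "\<exists>D. ((\<lambda>s. (norm (y s))\<^sup>2) has_real_derivative D) (at u) \<and> D \<le> - ?r * (norm (y u))\<^sup>2"
      using lyapunov_decrease[OF M trig[of k u, unfolded nu_def] \<sigma> lam[unfolded nu_def]] that u
      unfolding y_def nu_def by (intro exI conjI) auto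
  qed
  obtain j where j: "t j = ?b"
    using range period_in_update_times[of p T Toff \<tau>] by (metis imageE)
  \<comment> \<open>Induction on the number \<open>m\<close> of updates after the start of the
    window; chaining the intervals multiplies the exponentials, whose exponents add up.\<close>
  have decay: "(norm (y s))\<^sup>2 \<le> (norm (y ?b))\<^sup>2 * exp (- ?r * (s - ?b))"
    if "?b \<le> s" "s \<le> ?c" "s \<le> t (j + m)" for s m
    using that
  proof (induction m arbitrary: s)
    case 0
    then show ?case using j by simp
  next
    case (Suc m)
    show ?case
    proof (cases "s \<le> t (j + m)")
      case False
      have "?b \<le> t (j + m)" using mono j by (metis le_add1 strict_mono_less_eq)
      then have "(norm (y s))\<^sup>2 \<le> (norm (y (t (j + m))))\<^sup>2 * exp (- ?r * (s - t (j + m)))"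
        using False Suc.prems by (intro step[of "j + m"]) auto
      also have "\<dots> \<le> (norm (y ?b))\<^sup>2 * exp (- ?r * (t (j + m) - ?b)) * exp (- ?r * (s - t (j + m)))"
        using False Suc.prems \<open>?b \<le> t (j + m)\<close> by (intro mult_right_mono Suc.IH) auto
      also have "\<dots> = (norm (y ?b))\<^sup>2 * exp (- ?r * (s - ?b))"
        unfolding mult.assoc exp_add[symmetric] by (simp add: algebra_simps)
      finally show ?thesis .
    qed (use Suc in auto)
  qed
  show "(norm (y s))\<^sup>2 \<le> (norm (y ?b))\<^sup>2 * exp (- ?r * (s - ?b))"
    if s: "?b \<le> s" "s \<le> ?c" for s
  proof -
    obtain k where k: "t k \<le> s" "s < t (Suc k)"
      using update_sequence_bracket[OF t T] b0 s by (metis order_trans)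
    have "s \<le> t (j + Suc k)" using k mono by (metis le_add2 less_imp_le order_trans strict_mono_less_eq)
    then show ?thesis using decay[OF s] by blast
  qed
  show "(norm (x s))\<^sup>2 \<le> exp ((2 * matrix_norm A + 1) * T) * (matrix_norm M)\<^sup>2 *
        (1 + (3 * lam + 1 + nu + matrix_norm A)\<^sup>2) * (norm (y ?c))\<^sup>2"
    if s: "?c \<le> s" "s \<le> real (Suc p) * T" for s
  proof -
    have c0: "0 \<le> ?c" using b0 jammer by simp
    obtain k where k: "t k \<le> ?c" "?c < t (Suc k)"
      using update_sequence_bracket[OF t T c0] by metis
    \<comment> \<open>The first update after the window comes no earlier than the period end, so the
      input \<open>x (t k)\<close> provides is held over the whole jammed stretch.\<close>
    have "t (Suc k) \<in> update_times Toff T \<tau>" using range by auto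
    from no_update_while_jammed[OF this k(2) T jammer(1)]
    have k': "real (Suc p) * T \<le> t (Suc k)" .
    let ?w = "F *v x (t k)" let ?L = "3 * lam + 1 + nu + matrix_norm A"
    have "(norm (x s))\<^sup>2 \<le> (norm (x s))\<^sup>2 + (norm ?w)\<^sup>2" by simp
    also have "\<dots> \<le> ((norm (x ?c))\<^sup>2 + (norm ?w)\<^sup>2) * exp ((2 * matrix_norm A + 1) * (s - ?c))"
      using s k k' c0 by (intro affine_ode_growth cont deriv) auto
    also have "\<dots> \<le> ((matrix_norm M * norm (y ?c))\<^sup>2 + (matrix_norm M * ?L * norm (y ?c))\<^sup>2)
        * exp ((2 * matrix_norm A + 1) * T)"
    proof (intro mult_mono add_mono power_mono)
      have "x ?c = M *v y ?c"
        using M(1) by (simp add: y_def matrix_vector_mul_assoc matrix_inv_mult)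
      then show "norm (x ?c) \<le> matrix_norm M * norm (y ?c)"
        by (metis norm_matrix_vector_le)
      show "norm ?w \<le> matrix_norm M * ?L * norm (y ?c)"
        using held_input_bound[OF M trig[of k ?c, unfolded nu_def] \<sigma> lam[unfolded nu_def]] k jammer
        unfolding y_def nu_def by simp
      have "s - ?c \<le> T" using s jammer b0 by (simp add: algebra_simps)
      then show "exp ((2 * matrix_norm A + 1) * (s - ?c)) \<le> exp ((2 * matrix_norm A + 1) * T)"
        using matrix_norm_nonneg[of A] by (simp add: mult_left_mono)
    qed auto
    also have "\<dots> = exp ((2 * matrix_norm A + 1) * T) * (matrix_norm M)\<^sup>2 * (1 + ?L\<^sup>2) * (norm (y ?c))\<^sup>2"
    proof -
      have "((m * v)\<^sup>2 + (m * l * v)\<^sup>2) * E = E * m\<^sup>2 * (1 + l\<^sup>2) * v\<^sup>2" for m v l E :: real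
        by (simp add: power2_eq_square algebra_simps)
      then show ?thesis .
    qed
    finally show ?thesis .
  qed
qed

text \<open>\<open>D\<close> bounds the squared norm of \<open>x\<close> during jamming relative to
  that of \<open>y\<close> at the end of the window. Returning from \<open>x\<close> to
  \<open>y\<close> costs the squared norm of the inverse, so \<open>contr\<close> says that one full
  period at least halves the squared norm of \<open>y\<close>.\<close>

lemma jammed_loop_stable:
  fixes M :: "('n::{finite,linorder}) sq_mat"
    and a :: "nat \<Rightarrow> real" and lam T :: real
  defines "A \<equiv> ccf_A a :: 'n sq_mat" and "nu \<equiv> matrix_norm (shift_N :: 'n sq_mat)"
  defines "D \<equiv> exp ((2 * matrix_norm A + 1) * T) * (matrix_norm M)\<^sup>2 *
        (1 + (3 * lam + 1 + nu + matrix_norm A)\<^sup>2)"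
  assumes t: "update_sequence Toff T \<tau> t"
    and jammer: "0 < Toff" "Toff < T"
    and bound: "inter_event_bound a \<sigma> lam M \<tau>"
    and M: "invertible M" "ccf_A a + ccf_B ** gain a lam = M ** jordan_J lam ** matrix_inv M"
    and \<sigma>: "0 < \<sigma>" "\<sigma> < 1" and lam: "nu + 1/2 < lam"
    and contr: "(matrix_norm (matrix_inv M))\<^sup>2 * D * exp (- ((1 - \<sigma>) * (2 * lam - 1 - 2 * nu)) * Toff) \<le> 1/2"
  shows "asymptotically_stable (sampled_solution (ccf_A a :: 'n sq_mat) ccf_B (gain a lam) t)"
proof (rule asymptotically_stable_geometric)
  let ?r = "(1 - \<sigma>) * (2 * lam - 1 - 2 * nu)"
  show T: "0 < T" using jammer by simp
  have D0: "0 \<le> D" by (simp add: D_def)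
  then show "0 \<le> D * (matrix_norm (matrix_inv M))\<^sup>2" by simp
  have r0: "0 \<le> ?r" using \<sigma> lam by simp
  fix x :: "real \<Rightarrow> 'n rvec" and s :: real
  assume sol: "sampled_solution (ccf_A a) ccf_B (gain a lam) t x" and s: "0 \<le> s"
  define y where "y s = matrix_inv M *v x s" for s
  note sleep = decay_while_sleeping[OF sol t jammer bound M \<sigma> lam[unfolded nu_def],
      folded y_def nu_def A_def]
  note jam = growth_while_jammed[OF sol t jammer bound M \<sigma> lam[unfolded nu_def],
      folded y_def nu_def A_def, folded D_def]
  have y_le: "(norm (y s))\<^sup>2 \<le> (matrix_norm (matrix_inv M))\<^sup>2 * (norm (x s))\<^sup>2" for s
    using power_mono[OF norm_matrix_vector_le[of "matrix_inv M" "x s"], of 2]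
    by (simp add: y_def power_mult_distrib)
  have period: "(norm (y (real p * T)))\<^sup>2 \<le> (1/2) ^ p * (norm (y 0))\<^sup>2" for p
  proof (induction p)
    case (Suc p)
    have "(norm (y (real (Suc p) * T)))\<^sup>2 \<le> (matrix_norm (matrix_inv M))\<^sup>2 * (D * (norm (y (real p * T + Toff)))\<^sup>2)"
      using jammer by (intro order_trans[OF y_le] mult_left_mono jam) (auto simp: algebra_simps)
    also have "\<dots> \<le> (matrix_norm (matrix_inv M))\<^sup>2 * (D * ((norm (y (real p * T)))\<^sup>2 * exp (- ?r * Toff)))"
      using sleep[of p "real p * T + Toff"] D0 jammer by (intro mult_left_mono) auto
    also have "\<dots> = ((matrix_norm (matrix_inv M))\<^sup>2 * D * exp (- ?r * Toff)) * (norm (y (real p * T)))\<^sup>2"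
      by (simp only: ac_simps)
    also have "\<dots> \<le> 1/2 * (norm (y (real p * T)))\<^sup>2"
      using contr by (rule mult_right_mono) simp
    also have "\<dots> \<le> (1/2) ^ Suc p * (norm (y 0))\<^sup>2"
      using Suc by simp
    finally show ?case .
  qed simp
  define p where "p = nat \<lfloor>s / T\<rfloor>"
  have "real p \<le> s / T" "s / T < real p + 1"
    using s T by (simp_all add: p_def)
  then have p: "real p * T \<le> s" "s \<le> real (Suc p) * T"
    using T by (simp_all add: field_simps)
  have within: "(norm (y u))\<^sup>2 \<le> (norm (y (real p * T)))\<^sup>2"
    if "real p * T \<le> u" "u \<le> real p * T + Toff" for u
  proof -
    have "(norm (y (real p * T)))\<^sup>2 * exp (- ?r * (u - real p * T)) \<le> (norm (y (real p * T)))\<^sup>2 * 1"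
      using that r0 by (intro mult_left_mono) auto
    from order_trans[OF sleep[OF that] this] show ?thesis by (simp only: mult_1_right)
  qed
  \<comment> \<open>Hence the constant \<open>D\<close> also covers the sleeping part of the
    period.\<close>
  have D1: "(matrix_norm M)\<^sup>2 \<le> D"
  proof -
    have "1 * 1 \<le> exp ((2 * matrix_norm A + 1) * T) * (1 + (3 * lam + 1 + nu + matrix_norm A)\<^sup>2)"
      using T matrix_norm_nonneg[of A] by (intro mult_mono) auto
    from mult_left_mono[OF this, of "(matrix_norm M)\<^sup>2"] show ?thesis
      by (simp add: D_def mult_ac)
  qed
  have "(norm (x s))\<^sup>2 \<le> D * (norm (y (real p * T)))\<^sup>2"
  proof (cases "s \<le> real p * T + Toff")
    case True
    have "x s = M *v y s"
      using M(1) by (simp add: y_def matrix_vector_mul_assoc matrix_inv_mult)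
    then have "(norm (x s))\<^sup>2 \<le> (matrix_norm M)\<^sup>2 * (norm (y s))\<^sup>2"
      using power_mono[OF norm_matrix_vector_le[of M "y s"], of 2] by (simp add: power_mult_distrib)
    also have "\<dots> \<le> D * (norm (y (real p * T)))\<^sup>2"
      using D0 by (intro mult_mono D1 within p(1) True) auto
    finally show ?thesis .
  next
    case False
    then have "(norm (x s))\<^sup>2 \<le> D * (norm (y (real p * T + Toff)))\<^sup>2"
      using p by (intro jam) auto
    also have "\<dots> \<le> D * (norm (y (real p * T)))\<^sup>2"
      using D0 jammer by (intro mult_left_mono within) auto
    finally show ?thesis .
  qed
  also have "\<dots> \<le> D * ((1/2) ^ p * ((matrix_norm (matrix_inv M))\<^sup>2 * (norm (x 0))\<^sup>2))"
    using D0 by (intro mult_left_mono order_trans[OF period] y_le) auto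
  finally show "(norm (x s))\<^sup>2 \<le> D * (matrix_norm (matrix_inv M))\<^sup>2 * (1/2) ^ nat \<lfloor>s / T\<rfloor> * (norm (x 0))\<^sup>2"
    by (simp add: p_def mult_ac)
qed

text \<open>Here \<open>P\<close> and \<open>Q\<close> stand for the transformation and its inverse.
  Once the factor \<open>exp (c * b)\<close> is split off, a subexponential function is left against
  \<open>exp (- (2 * c) * s)\<close>.\<close>

lemma eventually_contracting:
  fixes P Q :: "real \<Rightarrow> real^'n^'m"
  assumes "0 < (c::real)" "\<And>i j. rational_on_pos (\<lambda>s. P s $ i $ j)" "\<And>i j. rational_on_pos (\<lambda>s. Q s $ i $ j)"
  shows "\<forall>\<^sub>F s in at_top. (matrix_norm (Q s))\<^sup>2 * (E * (matrix_norm (P s))\<^sup>2 * (1 + (3 * s + d)\<^sup>2))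
     * exp (- (c * (2 * s - b))) \<le> 1/2"
proof -
  have "subexponential (\<lambda>s. exp (c * b) * ((matrix_norm (Q s))\<^sup>2 * (E * (matrix_norm (P s))\<^sup>2 * (1 + (3 * s + d)\<^sup>2))))"
    unfolding power2_eq_square
    by (intro subexponential_mult subexponential_add subexponential_const subexponential_ident
        subexponential_matrix_norm assms)
  then have lim: "((\<lambda>s. exp (c * b) * ((matrix_norm (Q s))\<^sup>2 * (E * (matrix_norm (P s))\<^sup>2 * (1 + (3 * s + d)\<^sup>2)))
     * exp (- (2 * c) * s)) \<longlongrightarrow> 0) at_top"
    using assms(1) unfolding subexponential_def by simp
  have e: "exp (- (c * (2 * s - b))) = exp (c * b) * exp (- (2 * c) * s)" for s
    by (subst exp_add[symmetric], rule arg_cong[where f = exp]) (simp add: algebra_simps)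
  have "((\<lambda>s. (matrix_norm (Q s))\<^sup>2 * (E * (matrix_norm (P s))\<^sup>2 * (1 + (3 * s + d)\<^sup>2))
     * exp (- (c * (2 * s - b)))) \<longlongrightarrow> 0) at_top"
    using lim unfolding e by (simp only: ac_simps)
  then have "\<forall>\<^sub>F s in at_top. (matrix_norm (Q s))\<^sup>2 * (E * (matrix_norm (P s))\<^sup>2 * (1 + (3 * s + d)\<^sup>2))
     * exp (- (c * (2 * s - b))) < 1/2"
    by (rule order_tendstoD(2)) simp
  then show ?thesis by (rule eventually_mono) simp
qed

theorem theoremV1:
  fixes a :: "nat \<Rightarrow> real"
    and Tm :: "real \<Rightarrow> ('n::{finite,linorder}) sq_mat"
    and \<tau> :: "real \<Rightarrow> real"
    and \<sigma> Toff T :: real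
  assumes dim: "CARD('n) \<le> 4"
    and open_loop_unstable: "\<not> lyapunov_stable (linear_solution (ccf_A a :: 'n sq_mat))"
    and sigma: "0 < \<sigma>" "\<sigma> < 1"
    and jammer: "0 < Toff" "Toff < T"
    and Tm: "jordan_transform a Tm"
    and tau: "\<And>lam. lam > matrix_norm (shift_N :: 'n sq_mat) + 1/2 \<Longrightarrow>
                inter_event_bound a \<sigma> lam (Tm lam) (\<tau> lam)"
  shows "\<exists>lams > matrix_norm (shift_N :: 'n sq_mat) + 1/2. \<forall>lam\<ge>lams.
           \<forall>t. update_sequence Toff T (\<tau> lam) t \<longrightarrow>
             asymptotically_stable
               (sampled_solution (ccf_A a :: 'n sq_mat) ccf_B (gain a lam) t)"
proof -
  let ?A = "ccf_A a :: 'n sq_mat"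
  define nu where "nu = matrix_norm (shift_N :: 'n sq_mat)"
  have nu0: "0 \<le> nu" by (simp add: nu_def matrix_norm_nonneg)
  \<comment> \<open>The rate is \<open>c = (1 - \<sigma>) * Toff\<close>, positive because
    \<open>\<sigma> < 1\<close> and \<open>0 < Toff\<close>; the jammed growth enters only through a
    factor free of \<open>lam\<close>.\<close>
  have "\<forall>\<^sub>F lam in at_top. (matrix_norm (matrix_inv (Tm lam)))\<^sup>2 *
      (exp ((2 * matrix_norm ?A + 1) * T) * (matrix_norm (Tm lam))\<^sup>2
        * (1 + (3 * lam + (1 + nu + matrix_norm ?A))\<^sup>2))
      * exp (- (((1 - \<sigma>) * Toff) * (2 * lam - (1 + 2 * nu)))) \<le> 1/2"
    using Tm sigma jammer unfolding jordan_transform_def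
    by (intro eventually_contracting) auto
  then obtain L where L: "\<And>lam. lam \<ge> L \<Longrightarrow> (matrix_norm (matrix_inv (Tm lam)))\<^sup>2 *
      (exp ((2 * matrix_norm ?A + 1) * T) * (matrix_norm (Tm lam))\<^sup>2
        * (1 + (3 * lam + (1 + nu + matrix_norm ?A))\<^sup>2))
      * exp (- (((1 - \<sigma>) * Toff) * (2 * lam - (1 + 2 * nu)))) \<le> 1/2"
    unfolding eventually_at_top_linorder by blast
  have "asymptotically_stable (sampled_solution ?A ccf_B (gain a lam) t)"
    \<comment> \<open>The bound \<open>L\<close> secures the contraction, while
      \<open>nu + 1\<close> keeps \<open>lam\<close> above \<open>nu + 1/2\<close> and positive, as
      the Jordan decomposition requires.\<close>
    if lam: "lam \<ge> max L (nu + 1)" and t: "update_sequence Toff T (\<tau> lam) t" for lam t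
  proof (rule jammed_loop_stable[OF t jammer])
    show "inter_event_bound a \<sigma> lam (Tm lam) (\<tau> lam)"
      using lam by (intro tau) (simp flip: nu_def)
    show "invertible (Tm lam)" "?A + ccf_B ** gain a lam = Tm lam ** jordan_J lam ** matrix_inv (Tm lam)"
      using Tm lam nu0 unfolding jordan_transform_def by auto
    have "- ((1 - \<sigma>) * (2 * lam - 1 - 2 * nu)) * Toff = - (((1 - \<sigma>) * Toff) * (2 * lam - (1 + 2 * nu)))"
      by (simp add: algebra_simps)
    then show "(matrix_norm (matrix_inv (Tm lam)))\<^sup>2 *
      (exp ((2 * matrix_norm ?A + 1) * T) * (matrix_norm (Tm lam))\<^sup>2 *
        (1 + (3 * lam + 1 + matrix_norm (shift_N :: 'n sq_mat) + matrix_norm ?A)\<^sup>2))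
      * exp (- ((1 - \<sigma>) * (2 * lam - 1 - 2 * matrix_norm (shift_N :: 'n sq_mat))) * Toff) \<le> 1/2"
      using L[of lam] lam by (simp only: nu_def add.assoc max.bounded_iff)
    show "matrix_norm (shift_N :: 'n sq_mat) + 1/2 < lam"
      using lam by (simp flip: nu_def)
  qed (fact sigma)+
  then show ?thesis
    by (intro exI[of _ "max L (nu + 1)"]) (auto simp flip: nu_def)
qed

end
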